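(* Let $(X,d)$ be a metric space, $f:X\to\mathbb{R}\cup\{\pm\infty\}$ a function and $\bar x\in X$ such that $f(\bar x)=0$. If $f^\downarrow(\bar x)>0$, then for every function $g:X\to\mathbb{R}\cup\{\pm\infty\}$ such that $g(\bar x)=0$ and $|\nabla g|(\bar x)<f^\downarrow(\bar x)$, the function $f+g$ admits a local error bound at $\bar x$, and it results in $$f^\downarrow(\bar x)-|\nabla g|(\bar x)\le\mathrm{Er}(f+g)(\bar x).$$
   Context: $B(x,r)$ denotes the closed ball with center $x$ and radius $r$. The steepest descent rate of $f$ at $\bar x$ is $f^\downarrow(\bar x)=\liminf_{x\to\bar x}\frac{f(x)-f(\bar x)}{d(x,\bar x)}=\sup_{\delta>0}\inf_{x\in B(\bar x,\delta)\setminus\{\bar x\}}\frac{f(x)-f(\bar x)}{d(x,\bar x)}$ (with $\inf\varnothing=+\infty$). The strong slope of $g$ at $\bar x$ is $|\nabla g|(\bar x)=0$ if $\bar x$ is a local minimizer of $g$, and $|\nabla g|(\bar x)=\limsup_{x\to\bar x}\frac{g(\bar x)-g(x)}{d(x,\bar x)}$ (limsup over $x\ne\bar x$) otherwise. Write $[h\le 0]=\{x\in X: h(x)\le 0\}$, $[r]_+=\max\{r,0\}$, and $\mathrm{dist}(x,S)=\inf_{y\in S}d(x,y)$. A function $h:X\to\mathbb{R}\cup\{\pm\infty\}$ with $h(\bar x)=0$ admits a local error bound at $\bar x$ if there exist reals $c>0$ and $r>0$ such that $\mathrm{dist}(x,[h\le 0])\le c[h(x)]_+$ for all $x\in B(\bar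 x,r)$. Its error bound modulus at $\bar x$ is $\mathrm{Er}h(\bar x)=\liminf_{x\to\bar x,\ h(x)>0}\frac{h(x)}{\mathrm{dist}(x,[h\le 0])}$ (equal to $+\infty$ if there are no points $x$ with $h(x)>0$ in some neighbourhood of $\bar x$; a quotient with positive numerator and zero denominator is $+\infty$). At points where $f+g$ has the form $(+\infty)+(-\infty)$ any fixed value may be assigned; under the hypotheses no such points exist near $\bar x$. *)

theory Defs
  imports "HOL-Analysis.Analysis"
begin

text \<open>
  Conventions inherited from \<open>ereal\<close> and \<open>Liminf\<close>: the filter \<open>at x\<close> excludes \<open>x\<close>,
  a \<open>Liminf\<close> along the trivial filter is \<open>\<infinity>\<close>, a positive number divided by \<open>0\<close> is \<open>\<infinity>\<close>,
  and the indeterminate sum of \<open>\<infinity>\<close> and \<open>-\<infinity>\<close> is \<open>\<infinity>\<close>.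
\<close>

definition steepest_descent_rate :: "('a::metric_space \<Rightarrow> ereal) \<Rightarrow> 'a \<Rightarrow> ereal" where
  "steepest_descent_rate f x = Liminf (at x) (\<lambda>y. (f y - f x) / ereal (dist y x))"

definition local_minimizer :: "('a::metric_space \<Rightarrow> ereal) \<Rightarrow> 'a \<Rightarrow> bool" where
  "local_minimizer g x \<longleftrightarrow> (\<forall>\<^sub>F y in nhds x. g x \<le> g y)"

definition strong_slope :: "('a::metric_space \<Rightarrow> ereal) \<Rightarrow> 'a \<Rightarrow> ereal" where
  "strong_slope g x =
     (if local_minimizer g x then 0
      else Limsup (at x) (\<lambda>y. (g x - g y) / ereal (dist y x)))"

definition sublevel0 :: "('a \<Rightarrow> ereal) \<Rightarrow> 'a set" where
  "sublevel0 h = {x. h x \<le> 0}"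

text \<open>
  The next two notions are meant for \<open>h x = 0\<close>. Then \<open>sublevel0 h\<close> is nonempty, so the
  library's value \<open>infdist y {} = 0\<close> plays no role, and the exclusion of \<open>x\<close> by
  \<open>at x within {y. 0 < h y}\<close> is vacuous.
\<close>

definition local_error_bound :: "('a::metric_space \<Rightarrow> ereal) \<Rightarrow> 'a \<Rightarrow> bool" where
  "local_error_bound h x \<longleftrightarrow>
     (\<exists>c r :: real. 0 < c \<and> 0 < r \<and>
        (\<forall>y \<in> cball x r. ereal (infdist y (sublevel0 h)) \<le> ereal c * max (h y) 0))"

definition error_bound_modulus :: "('a::metric_space \<Rightarrow> ereal) \<Rightarrow> 'a \<Rightarrow> ereal" where
  "error_bound_modulus h x =
     Liminf (at x within {y. 0 < h y}) (\<lambda>y. h y / ereal (infdist y (sublevel0 h)))"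

end

theory Submission
  imports Defs
begin

text \<open>
  If \<open>k < f\<^sup>\<down>(x) - |\<nabla>g|(x)\<close>, split \<open>k = a - b\<close> with \<open>|\<nabla>g|(x) < b\<close> and \<open>a < f\<^sup>\<down>(x)\<close>. Near \<open>x\<close> this
  gives \<open>f y > a d(y, x)\<close> and \<open>g y \<ge> - b d(y, x)\<close>, so \<open>f + g\<close> grows at least like \<open>k d(y, x)\<close>, and
  \<open>d(y, x)\<close> bounds the distance to the sublevel set because \<open>x\<close> belongs to it.
\<close>

text \<open>A negative limsup would make all difference quotients near \<open>x\<close> negative,
  hence \<open>g x \<le> g y\<close> there, so \<open>x\<close> would be a local minimizer, contrary
  to the branch of the definition. Isolated points are local minimizers, so an empty limsup does no
  harm.\<close>

lemma strong_slope_nonneg: "0 \<le> strong_slope g x"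
proof (cases "local_minimizer g x")
  case False
  show ?thesis
  proof (rule ccontr)
    assume "\<not> ?thesis"
    then have "Limsup (at x) (\<lambda>y. (g x - g y) / ereal (dist y x)) < 0"
      using False by (simp add: strong_slope_def not_le)
    then have "\<forall>\<^sub>F y in at x. (g x - g y) / ereal (dist y x) < 0"
      by (rule Limsup_lessD)
    then have "\<forall>\<^sub>F y in nhds x. y \<noteq> x \<longrightarrow> (g x - g y) / ereal (dist y x) < 0"
      by (simp add: eventually_at_filter)
    then have "\<forall>\<^sub>F y in nhds x. g x \<le> g y"
    proof eventually_elim
      case (elim y)
      show ?case
      proof (rule ccontr)
        assume "\<not> g x \<le> g y"
        then have "y \<noteq> x" "0 \<le> g x - g y"
          by (auto simp: ereal_diff_positive)
        then have "0 \<le> (g x - g y) / ereal (dist y x)"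
          by (intro zero_le_divide_ereal) auto
        with elim \<open>y \<noteq> x\<close> show False by simp
      qed
    qed
    with False show False by (simp add: local_minimizer_def)
  qed
qed (simp add: strong_slope_def)

lemma eventually_steepest_descent_rate_lower:
  fixes f :: "'a::metric_space \<Rightarrow> ereal"
  assumes "f x = 0" "ereal a < steepest_descent_rate f x"
  shows "\<forall>\<^sub>F y in at x. ereal (a * dist y x) < f y"
proof -
  have "\<forall>\<^sub>F y in at x. ereal a < (f y - f x) / ereal (dist y x)"
    using assms(2) unfolding steepest_descent_rate_def by (rule less_LiminfD)
  moreover have "\<forall>\<^sub>F y in at x. y \<noteq> x"
    by (simp add: eventually_at_filter)
  ultimately show ?thesis
  proof eventually_elim
    case (elim y)
    then show ?case
      \<comment> \<open>For \<open>y \<noteq> x\<close> the divisor is a positive real, so an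
        infinite \<open>f y\<close> passes unchanged to the quotient; \<open>elim\<close> thus
        excludes the value \<open>-\<infinity>\<close>.\<close>
      using assms(1) by (cases "f y") (auto simp: field_simps)
  qed
qed

lemma eventually_strong_slope_lower:
  fixes g :: "'a::metric_space \<Rightarrow> ereal"
  assumes "g x = 0" "strong_slope g x < ereal b"
  shows "\<forall>\<^sub>F y in at x. ereal (- b * dist y x) \<le> g y"
proof (cases "local_minimizer g x")
  case True
  \<comment> \<open>At a local minimizer only \<open>0 \<le> g y\<close> is known, which gives the
    bound because \<open>- b * dist y x\<close> is nonpositive.\<close>
  have "0 \<le> b"
    using order_le_less_trans[OF strong_slope_nonneg assms(2)] by simp
  from True have "\<forall>\<^sub>F y in at x. g x \<le> g y"
    unfolding local_minimizer_def by (auto simp: eventually_at_filter elim: eventually_mono)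
  then show ?thesis
  proof eventually_elim
    case (elim y)
    have "ereal (- b * dist y x) \<le> 0" using \<open>0 \<le> b\<close> by simp
    also have "0 \<le> g y" using elim assms(1) by simp
    finally show ?case .
  qed
next
  case False
  then have "\<forall>\<^sub>F y in at x. (g x - g y) / ereal (dist y x) < ereal b"
    using assms(2) by (intro Limsup_lessD) (simp add: strong_slope_def)
  moreover have "\<forall>\<^sub>F y in at x. y \<noteq> x"
    by (simp add: eventually_at_filter)
  ultimately show ?thesis
  proof eventually_elim
    case (elim y)
    then show ?case
      using assms(1) by (cases "g y") (auto simp: field_simps)
  qed
qed

lemma eventually_add_lower:
  fixes f g :: "'a::metric_space \<Rightarrow> ereal"
  assumes "f x = 0" "g x = 0"
    and less: "strong_slope g x < steepest_descent_rate f x"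
    and k: "ereal k < steepest_descent_rate f x - strong_slope g x"
  shows "\<forall>\<^sub>F y in at x. ereal (k * dist y x) \<le> f y + g y"
proof -
  \<comment> \<open>The slope is nonnegative and strictly below another value, hence real; it can be
    moved across the inequality even if the descent rate is infinite.\<close>
  obtain s where s: "strong_slope g x = ereal s"
    using less strong_slope_nonneg[of g x] by (cases "strong_slope g x") auto
  have "ereal (k + s) < steepest_descent_rate f x"
    using k s by (cases "steepest_descent_rate f x") auto
  \<comment> \<open>Strictness on the left makes \<open>b = a - k\<close> exceed \<open>s\<close>,
    so both one-sided estimates apply.\<close>
  then obtain a where a: "ereal (k + s) < ereal a" "ereal a < steepest_descent_rate f x"
    using ereal_dense2 by blast
  have "strong_slope g x < ereal (a - k)" using a(1) s by simp
  from eventually_steepest_descent_rate_lower[OF assms(1) a(2)]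
    eventually_strong_slope_lower[OF assms(2) this]
  show ?thesis
  proof eventually_elim
    case (elim y)
    \<comment> \<open>Both lower bounds are real, so neither summand is \<open>-\<infinity>\<close>
      and the sum is not indeterminate.\<close>
    have "ereal (k * dist y x) = ereal (a * dist y x) + ereal (- (a - k) * dist y x)"
      by (simp add: algebra_simps)
    also have "\<dots> \<le> f y + g y" using elim by (intro add_mono) auto
    finally show ?case .
  qed
qed

text \<open>The constant is \<open>1 / k\<close>: as \<open>x\<close> lies in the sublevel set, the
  distance to that set is at most \<open>dist y x\<close>, which is at most
  \<open>h y / k\<close>.\<close>

lemma local_error_boundI:
  fixes h :: "'a::metric_space \<Rightarrow> ereal"
  assumes "h x = 0" "0 < k" and ev: "\<forall>\<^sub>F y in at x. ereal (k * dist y x) \<le> h y"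
  shows "local_error_bound h x"
proof -
  have x: "x \<in> sublevel0 h" using assms(1) by (simp add: sublevel0_def)
  from ev obtain d where "d > 0"
    and d: "\<And>y. y \<noteq> x \<Longrightarrow> dist y x \<le> d \<Longrightarrow> ereal (k * dist y x) \<le> h y"
    by (auto simp: eventually_at_le)
  have "ereal (infdist y (sublevel0 h)) \<le> ereal (1 / k) * max (h y) 0" if "y \<in> cball x d" for y
  proof (cases "y = x")
    case True
    then show ?thesis using x assms(1) by (simp add: zero_ereal_def)
  next
    case False
    have "ereal (infdist y (sublevel0 h)) \<le> ereal (dist y x)"
      using infdist_le[OF x] by simp
    also have "\<dots> = ereal (1 / k) * ereal (k * dist y x)" using \<open>0 < k\<close> by simp
    also have "\<dots> \<le> ereal (1 / k) * max (h y) 0"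
      using d[OF False] that \<open>0 < k\<close>
      by (intro ereal_mult_left_mono) (auto simp: dist_commute le_max_iff_disj)
    finally show ?thesis .
  qed
  then show ?thesis
    unfolding local_error_bound_def using \<open>d > 0\<close> \<open>0 < k\<close>
    by (intro exI[of _ "1 / k"] exI[of _ d]) auto
qed

lemma error_bound_modulus_ge:
  fixes h :: "'a::metric_space \<Rightarrow> ereal"
  assumes "h x = 0" "0 < k" and ev: "\<forall>\<^sub>F y in at x. ereal (k * dist y x) \<le> h y"
  shows "ereal k \<le> error_bound_modulus h x"
  unfolding error_bound_modulus_def
proof (rule Liminf_bounded)
  have x: "x \<in> sublevel0 h" using assms(1) by (simp add: sublevel0_def)
  have "\<forall>\<^sub>F y in at x within {y. 0 < h y}. ereal (k * dist y x) \<le> h y"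
    using ev by (rule filter_leD[OF at_le, rotated]) simp
  moreover have "\<forall>\<^sub>F y in at x within {y. 0 < h y}. 0 < h y"
    by (simp add: eventually_at_filter)
  ultimately show "\<forall>\<^sub>F y in at x within {y. 0 < h y}.
      ereal k \<le> h y / ereal (infdist y (sublevel0 h))"
  proof eventually_elim
    case (elim y)
    show ?case
    proof (cases "infdist y (sublevel0 h) = 0")
      \<comment> \<open>The pointwise facts at \<open>y\<close> do not rule out distance 0; the
        positive numerator then makes the quotient \<open>\<infinity>\<close>.\<close>
      case True
      with elim(2) show ?thesis by (auto simp: divide_ereal_def simp flip: zero_ereal_def)
    next
      case False
      then have pos: "0 < infdist y (sublevel0 h)"
        using infdist_nonneg[of y "sublevel0 h"] by linarith
      have "ereal (k * infdist y (sublevel0 h)) \<le> ereal (k * dist y x)"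
        using infdist_le[OF x] \<open>0 < k\<close> by simp
      also have "\<dots> \<le> h y" by (rule elim(1))
      finally show ?thesis using pos by (simp add: ereal_le_divide_pos mult.commute)
    qed
  qed
qed

theorem corollary1:
  fixes f :: "'a::metric_space \<Rightarrow> ereal" and xbar :: 'a
  assumes "f xbar = 0"
    and "0 < steepest_descent_rate f xbar"
  shows "\<forall>g :: 'a \<Rightarrow> ereal.
    g xbar = 0 \<and> strong_slope g xbar < steepest_descent_rate f xbar \<longrightarrow>
      local_error_bound (\<lambda>x. f x + g x) xbar \<and>
      steepest_descent_rate f xbar - strong_slope g xbar
        \<le> error_bound_modulus (\<lambda>x. f x + g x) xbar"
proof (intro allI impI)
  fix g :: "'a \<Rightarrow> ereal"
  let ?h = "\<lambda>x. f x + g x"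
  let ?D = "steepest_descent_rate f xbar - strong_slope g xbar"
  assume g: "g xbar = 0 \<and> strong_slope g xbar < steepest_descent_rate f xbar"
  then have h: "?h xbar = 0" using assms(1) by simp
  have D: "0 < ?D"
    using g by (cases "strong_slope g xbar"; cases "steepest_descent_rate f xbar") auto
  have lower: "\<forall>\<^sub>F y in at xbar. ereal (k * dist y xbar) \<le> ?h y" if "ereal k < ?D" for k
    using assms(1) g that by (intro eventually_add_lower) auto
  show "local_error_bound ?h xbar \<and> ?D \<le> error_bound_modulus ?h xbar"
  proof
    obtain k where "0 < ereal k" "ereal k < ?D" using ereal_dense2[OF D] by blast
    then show "local_error_bound ?h xbar"
      using local_error_boundI[OF h _ lower, of k] by simp
    show "?D \<le> error_bound_modulus ?h xbar"
    \<comment> \<open>\<open>?D\<close> may be \<open>\<infinity>\<close>, so it is approached from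
      below through real \<open>k\<close>. Taking \<open>max z 0\<close> keeps \<open>k\<close>
      positive even for negative \<open>z\<close>.\<close>
    proof (rule dense_le)
      fix z assume "z < ?D"
      then have "max z 0 < ?D" using D by simp
      then obtain k where k: "max z 0 < ereal k" "ereal k < ?D" using ereal_dense2 by blast
      then have "ereal k \<le> error_bound_modulus ?h xbar"
        by (intro error_bound_modulus_ge[OF h _ lower]) auto
      with k(1) show "z \<le> error_bound_modulus ?h xbar" by (auto intro: order_trans less_imp_le)
    qed
  qed
qed

end
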